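(* There is a function $\varepsilon:\mathbb{N}\to\mathbb{R}$ with $\varepsilon(n)\to 0$ as $n\to\infty$ such that for every $n$ and every simple 2-CNF formula $\varphi$ on $n$ variables there is a 2-CNF formula $\varphi'$ with $\varphi \Rightarrow^{*}_{\mathrm{BVA}} \varphi'$ and $|\varphi'| \le \left(\frac{\lg 3}{4}+\varepsilon(n)\right)\frac{n^2}{\lg n}$.
   Context: A literal is a variable $x$ or its negation $\overline{x}$. A clause is a set of non-complementary literals, a formula is a set of clauses, and $|\varphi|$ is the number of clauses; $\textsf{Var}(\varphi)$ is the set of variables occurring in $\varphi$. A formula is 2-CNF if every clause has exactly two literals. $\lg$ is the base-2 logarithm. A 2-CNF formula $\varphi$ is simple if (a) there are no two distinct literals $\ell_1,\ell_2$ with $\varphi\models \ell_1\leftrightarrow\ell_2$, (b) every clause contains at least one negative literal, and (c) any two distinct clauses $C_1,C_2\in\varphi$ satisfy $\textsf{Var}(C_1)\ne\textsf{Var}(C_2)$. BVA step: let $\varphi$ be a formula, let $\mathcal{C},\mathcal{D}$ be sets of nonempty clauses such that $\mathcal{C}\bowtie\mathcal{D} := \{C\cup D : C\in\mathcal{C}, D\in\mathcal{D}\}\subseteq\varphi$, and let $y\notin\textsf{Var}(\varphi)$ be fresh. Then $\varphi' := (\varphi\setminus(\mathcal{C}\bowtie\mathcal{D}))\cup\{C\cup\{y\} : C\in\mathcal{C}\}\cup\{\{\overline{y}\}\cup D : D\in\mathcal{D}\}$ is derived in one BVA step, written $\varphi\Rightarrow_{\mathrm{BVA}}\varphi'$;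 $\Rightarrow^{*}_{\mathrm{BVA}}$ is the reflexive transitive closure of $\Rightarrow_{\mathrm{BVA}}$. *)

theory Defs
  imports Complex_Main "HOL-Library.Infinite_Typeclass"
begin

datatype 'v lit = Pos 'v | Neg 'v

primrec neg_lit :: "'v lit \<Rightarrow> 'v lit" where
  "neg_lit (Pos x) = Neg x"
| "neg_lit (Neg x) = Pos x"

primrec var_of :: "'v lit \<Rightarrow> 'v" where
  "var_of (Pos x) = x"
| "var_of (Neg x) = x"

type_synonym 'v clause = "'v lit set"
type_synonym 'v formula = "'v clause set"

definition is_clause :: "'v clause \<Rightarrow> bool" where
  "is_clause C \<longleftrightarrow> finite C \<and> (\<forall>l\<in>C. neg_lit l \<notin> C)"

text \<open>Finiteness matters: \<open>card\<close> is \<open>0\<close> on infinite sets.\<close>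

definition is_formula :: "'v formula \<Rightarrow> bool" where
  "is_formula F \<longleftrightarrow> finite F \<and> (\<forall>C\<in>F. is_clause C)"

definition clause_vars :: "'v clause \<Rightarrow> 'v set" where
  "clause_vars C = var_of ` C"

definition vars :: "'v formula \<Rightarrow> 'v set" where
  "vars F = (\<Union>C\<in>F. clause_vars C)"

definition two_cnf :: "'v formula \<Rightarrow> bool" where
  "two_cnf F \<longleftrightarrow> is_formula F \<and> (\<forall>C\<in>F. card C = 2)"

primrec lit_true :: "('v \<Rightarrow> bool) \<Rightarrow> 'v lit \<Rightarrow> bool" where
  "lit_true \<alpha> (Pos x) \<longleftrightarrow> \<alpha> x"
| "lit_true \<alpha> (Neg x) \<longleftrightarrow> \<not> \<alpha> x"

definition satisfies :: "('v \<Rightarrow> bool) \<Rightarrow> 'v formula \<Rightarrow> bool" where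
  "satisfies \<alpha> F \<longleftrightarrow> (\<forall>C\<in>F. \<exists>l\<in>C. lit_true \<alpha> l)"

definition entails_equiv :: "'v formula \<Rightarrow> 'v lit \<Rightarrow> 'v lit \<Rightarrow> bool" where
  "entails_equiv F l1 l2 \<longleftrightarrow>
     (\<forall>\<alpha>. satisfies \<alpha> F \<longrightarrow> (lit_true \<alpha> l1 \<longleftrightarrow> lit_true \<alpha> l2))"

definition simple_two_cnf :: "'v formula \<Rightarrow> bool" where
  "simple_two_cnf F \<longleftrightarrow> two_cnf F
     \<and> \<not> (\<exists>l1 l2. l1 \<noteq> l2 \<and> entails_equiv F l1 l2)
     \<and> (\<forall>C\<in>F. \<exists>x. Neg x \<in> C)
     \<and> (\<forall>C1\<in>F. \<forall>C2\<in>F. C1 \<noteq> C2 \<longrightarrow> clause_vars C1 \<noteq> clause_vars C2)"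

definition clause_product :: "'v clause set \<Rightarrow> 'v clause set \<Rightarrow> 'v clause set" where
  "clause_product \<C> \<D> = {C \<union> D | C D. C \<in> \<C> \<and> D \<in> \<D>}"

text \<open>
  Requiring \<open>is_formula F'\<close> restricts only the degenerate steps in which \<open>\<C>\<close> or \<open>\<D>\<close> is
  empty: there \<open>clause_product \<C> \<D> \<subseteq> F\<close> holds vacuously, and the other set could be infinite or
  mention \<open>y\<close>. In all other steps it follows from the remaining conditions.
\<close>

definition bva_step :: "'v formula \<Rightarrow> 'v formula \<Rightarrow> bool" where
  "bva_step F F' \<longleftrightarrow> is_formula F \<and> is_formula F' \<and>
     (\<exists>\<C> \<D> y.
        (\<forall>C\<in>\<C>. is_clause C \<and> C \<noteq> {}) \<and>
        (\<forall>D\<in>\<D>. is_clause D \<and> D \<noteq> {}) \<and>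
        clause_product \<C> \<D> \<subseteq> F \<and>
        y \<notin> vars F \<and>
        F' = (F - clause_product \<C> \<D>)
               \<union> {C \<union> {Pos y} | C. C \<in> \<C>}
               \<union> {{Neg y} \<union> D | D. D \<in> \<D>})"

end

theory Submission
  imports Defs "HOL-Library.Disjoint_Sets" "HOL-Library.FuncSet" "HOL-Real_Asymp.Real_Asymp"
begin

text \<open>
  Since no two literals are equivalent, the implications \<open>x \<rightarrow> y\<close> among positive literals are acyclic.
  In a topological order \<open>x\<^sub>0, \<dots>, x\<^bsub>n-1\<^esub>\<close> every clause is \<open>{\<not>x\<^sub>i, x\<^sub>j}\<close> or \<open>{\<not>x\<^sub>i, \<not>x\<^sub>j}\<close> with \<open>i < j\<close>,
  so the formula is an upper triangular matrix with three possible entries. Cut its columns into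
  strips of width \<open>k\<close> slightly below \<open>log\<^sub>3 n\<close>. In each strip a row has one of at most \<open>3\<^sup>k\<close> patterns;
  one BVA step per pattern replaces the entries of a row by a single clause linking the row to a
  variable for its pattern. Next, cut the rows into groups of size \<open>n / (ln n)\<^sup>2\<close>, so that there are
  only \<open>o(n\<^sup>2 / ln n)\<close> pairs of rows in a common group. In each strip, match the rows with the same
  pattern in the same group; one BVA step per pair then lets two matched rows share one clause.
  All but \<open>o(n\<^sup>2 / ln n)\<close> of the clauses are such shared clauses, half a clause per row and
  strip, and the triangle has \<open>n\<^sup>2 / (2 k)\<close> (row, strip) incidences, whence \<open>n\<^sup>2 / (4 k)\<close>.
\<close>

section \<open>Bicliques of literals and the BVA steps that replace them\<close>

text \<open>The clause product of the unit clauses over \<open>X\<close> with those over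
  \<open>Y\<close>; all BVA steps constructed below replace a product of this kind.\<close>

definition biclique :: "'v lit set \<Rightarrow> 'v lit set \<Rightarrow> 'v formula" where
  "biclique X Y = {{l, m} | l m. l \<in> X \<and> m \<in> Y}"

lemma finite_biclique: "finite X \<Longrightarrow> finite Y \<Longrightarrow> finite (biclique X Y)"
proof -
  assume "finite X" "finite Y"
  moreover have "biclique X Y = (\<lambda>(l, m). {l, m}) ` (X \<times> Y)"
    by (auto simp: biclique_def)
  ultimately show ?thesis by simp
qed

lemma var_of_neg_lit [simp]: "var_of (neg_lit l) = var_of l"
  by (cases l) auto

lemma neg_lit_neq [simp]: "neg_lit l \<noteq> l" "l \<noteq> neg_lit l"
  by (cases l; simp)+

text \<open>Distinct literals over one variable are complementary, so a two-element clause has two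
  different variables.\<close>

lemma two_cnf_iff:
  "two_cnf F \<longleftrightarrow> finite F \<and> (\<forall>C\<in>F. \<exists>l m. C = {l, m} \<and> var_of l \<noteq> var_of m)"
proof -
  have 1: "is_clause C \<and> card C = 2 \<longleftrightarrow> (\<exists>l m. C = {l, m} \<and> var_of l \<noteq> var_of m)" for C :: "'a clause"
  proof
    assume C: "is_clause C \<and> card C = 2"
    then obtain l m where lm: "C = {l, m}" "l \<noteq> m" by (meson card_2_iff)
    have "m \<noteq> neg_lit l" using C lm by (auto simp: is_clause_def)
    then have "var_of l \<noteq> var_of m" using lm(2) by (cases l; cases m) auto
    then show "\<exists>l m. C = {l, m} \<and> var_of l \<noteq> var_of m" using lm by blast
  next
    assume "\<exists>l m. C = {l, m} \<and> var_of l \<noteq> var_of m"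
    then obtain l m where lm: "C = {l, m}" "var_of l \<noteq> var_of m" by blast
    then have "neg_lit l \<noteq> m" "neg_lit m \<noteq> l" "l \<noteq> m" by auto
    then show "is_clause C \<and> card C = 2" using lm by (auto simp: is_clause_def)
  qed
  show ?thesis
    unfolding two_cnf_def is_formula_def 1[symmetric] by (simp add: ball_conj_distrib)
qed

lemma two_cnf_clauseE:
  assumes "two_cnf F" "C \<in> F"
  obtains l m where "C = {l, m}" "var_of l \<noteq> var_of m"
proof -
  have "\<exists>l m. C = {l, m} \<and> var_of l \<noteq> var_of m" using assms by (simp add: two_cnf_iff)
  then show thesis using that by (elim exE conjE)
qed

lemma finite_vars: "two_cnf F \<Longrightarrow> finite (vars F)"
  by (auto simp: two_cnf_def is_formula_def is_clause_def vars_def clause_vars_def)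

text \<open>Unit clauses extended by \<open>y\<close> or its negation have width two, so the formula
  stays 2-CNF. Freshness is asked with respect to \<open>X\<close> and \<open>Y\<close> too: if one
  of them is empty, the other may mention variables that do not occur in \<open>F\<close>.\<close>

lemma bva_step_biclique:
  assumes F: "two_cnf F" and fin: "finite X" "finite Y" and sub: "biclique X Y \<subseteq> F"
    and y: "y \<notin> vars F" "y \<notin> var_of ` (X \<union> Y)"
  defines "F' \<equiv> (F - biclique X Y) \<union> biclique X {Pos y} \<union> biclique {Neg y} Y"
  shows "bva_step F F'" and "two_cnf F'"
proof -
  show F': "two_cnf F'"
    unfolding two_cnf_iff
  proof (intro conjI ballI)
    have "finite F" using F by (simp add: two_cnf_def is_formula_def)
    then show "finite F'" using fin by (simp add: F'_def finite_biclique)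
    fix C assume "C \<in> F'"
    then consider "C \<in> F" | l where "C = {l, Pos y}" "l \<in> X" | l where "C = {Neg y, l}" "l \<in> Y"
      unfolding F'_def biclique_def by blast
    then show "\<exists>l m. C = {l, m} \<and> var_of l \<noteq> var_of m"
    proof cases
      case 1 then show ?thesis using F unfolding two_cnf_iff by blast
    next
      case 2 then have "var_of l \<noteq> var_of (Pos y)" using y(2) by auto
      then show ?thesis using 2 by blast
    next
      case 3 then have "var_of (Neg y) \<noteq> var_of l" using y(2) by auto
      then show ?thesis using 3 by blast
    qed
  qed
  let ?C = "(\<lambda>l. {l}) ` X" and ?D = "(\<lambda>l. {l}) ` Y"
  have cl: "is_clause {l}" for l :: "'a lit" by (simp add: is_clause_def)
  have prod: "clause_product ?C ?D = biclique X Y"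
    unfolding clause_product_def biclique_def by (auto simp: insert_is_Un[symmetric])
  have "F' = (F - clause_product ?C ?D) \<union> {C \<union> {Pos y} | C. C \<in> ?C} \<union> {{Neg y} \<union> D | D. D \<in> ?D}"
  proof -
    have "{C \<union> {Pos y} | C. C \<in> ?C} = biclique X {Pos y}"
      unfolding biclique_def by (auto simp: insert_is_Un[symmetric])
    moreover have "{{Neg y} \<union> D | D. D \<in> ?D} = biclique {Neg y} Y"
      unfolding biclique_def by (auto simp: insert_is_Un[symmetric])
    ultimately show ?thesis unfolding F'_def prod by simp
  qed
  moreover have "is_formula F" "is_formula F'" using F F' by (auto simp: two_cnf_def)
  moreover have "\<forall>C\<in>?C. is_clause C \<and> C \<noteq> {}" "\<forall>D\<in>?D. is_clause D \<and> D \<noteq> {}"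
    using cl by auto
  ultimately show "bva_step F F'"
    unfolding bva_step_def using prod sub y(1) by (intro conjI exI[of _ ?C] exI[of _ ?D] exI[of _ y]) simp_all
qed

lemma vars_biclique: "vars (biclique X Y) \<subseteq> var_of ` (X \<union> Y)"
  by (auto simp: vars_def biclique_def clause_vars_def)

lemma vars_Un: "vars (F \<union> G) = vars F \<union> vars G"
  by (auto simp: vars_def)

lemma vars_mono: "F \<subseteq> G \<Longrightarrow> vars F \<subseteq> vars G"
  by (auto simp: vars_def)

text \<open>Disjointness keeps each biclique intact until its turn, so the result of all steps has a
  closed form in which clauses can be counted. \<open>S\<close> is a common stock of old variables
  that all fresh ones avoid.\<close>

lemma bva_family:
  fixes F :: "'v::infinite formula"
  assumes "finite I" and F: "two_cnf F" and S: "finite S" "vars F \<subseteq> S"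
    and "\<And>a. a \<in> I \<Longrightarrow> finite (X a) \<and> finite (Y a) \<and> var_of ` (X a \<union> Y a) \<subseteq> S"
    and "\<And>a. a \<in> I \<Longrightarrow> biclique (X a) (Y a) \<subseteq> F"
    and "disjoint_family_on (\<lambda>a. biclique (X a) (Y a)) I"
  shows "\<exists>v. inj_on v I \<and> v ` I \<inter> S = {} \<and>
    (let F' = (F - (\<Union>a\<in>I. biclique (X a) (Y a)))
        \<union> (\<Union>a\<in>I. biclique (X a) {Pos (v a)} \<union> biclique {Neg (v a)} (Y a))
     in two_cnf F' \<and> bva_step\<^sup>*\<^sup>* F F')"
  using assms(1,5,6,7)
proof (induction I rule: finite_induct)
  case empty
  then show ?case using F by (simp add: Let_def)
next
  case (insert b I)
  define G where "G v I = (F - (\<Union>a\<in>I. biclique (X a) (Y a)))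
        \<union> (\<Union>a\<in>I. biclique (X a) {Pos (v a)} \<union> biclique {Neg (v a)} (Y a))" for v I
  have "disjoint_family_on (\<lambda>a. biclique (X a) (Y a)) I"
    using insert.prems(3) by (auto simp: disjoint_family_on_def)
  then obtain v where v: "inj_on v I" "v ` I \<inter> S = {}" "two_cnf (G v I)" "bva_step\<^sup>*\<^sup>* F (G v I)"
    using insert.IH insert.prems(1,2) unfolding G_def Let_def by (metis (no_types, lifting) insertCI)
  have "finite (S \<union> v ` I)" using S(1) insert.hyps(1) by simp
  then obtain y where y: "y \<notin> S" "y \<notin> v ` I" using ex_new_if_finite[OF infinite_UNIV] by blast
  let ?P = "biclique (X b) (Y b)"
  have Pdis: "?P \<inter> (\<Union>a\<in>I. biclique (X a) (Y a)) = {}"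
    using insert.prems(3) insert.hyps(2) by (auto simp: disjoint_family_on_def)
  have PF: "?P \<subseteq> F" using insert.prems(2) by simp
  have PG: "?P \<subseteq> G v I" using Pdis PF by (auto simp: G_def)
  have vG: "vars (G v I) \<subseteq> S \<union> v ` I"
  proof -
    have "vars (biclique (X a) {Pos (v a)}) \<subseteq> S \<union> v ` I" "vars (biclique {Neg (v a)} (Y a)) \<subseteq> S \<union> v ` I"
      if "a \<in> I" for a
    proof -
      have "var_of ` (X a \<union> Y a) \<subseteq> S" "v a \<in> v ` I" using insert.prems(1)[of a] that by simp_all
      then have "var_of ` (X a \<union> {Pos (v a)}) \<subseteq> S \<union> v ` I" "var_of ` ({Neg (v a)} \<union> Y a) \<subseteq> S \<union> v ` I"
        by auto
      then show "vars (biclique (X a) {Pos (v a)}) \<subseteq> S \<union> v ` I" "vars (biclique {Neg (v a)} (Y a)) \<subseteq> S \<union> v ` I"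
        using vars_biclique by (metis subset_trans)+
    qed
    then have "vars (\<Union>a\<in>I. biclique (X a) {Pos (v a)} \<union> biclique {Neg (v a)} (Y a)) \<subseteq> S \<union> v ` I"
      unfolding vars_def by blast
    moreover have "vars (F - (\<Union>a\<in>I. biclique (X a) (Y a))) \<subseteq> S"
      using S(2) vars_mono[of "F - _" F] by blast
    ultimately show ?thesis unfolding G_def vars_Un by blast
  qed
  have "y \<notin> vars (G v I)" "y \<notin> var_of ` (X b \<union> Y b)"
    using vG y insert.prems(1)[of b] by auto
  then have step: "bva_step (G v I) ((G v I - ?P) \<union> biclique (X b) {Pos y} \<union> biclique {Neg y} (Y b))"
    "two_cnf ((G v I - ?P) \<union> biclique (X b) {Pos y} \<union> biclique {Neg y} (Y b))"
    using bva_step_biclique[OF v(3) _ _ PG] insert.prems(1)[of b] by auto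
  define w where "w = v(b := y)"
  have wI: "w a = v a" if "a \<in> I" for a using that insert.hyps(2) by (auto simp: w_def)
  \<comment> \<open>Clauses added earlier contain some \<open>v a\<close> outside
    \<open>vars F\<close>, so removing the biclique of \<open>b\<close>, a subset of
    \<open>F\<close>, deletes none of them.\<close>
  have Pnew: "?P \<inter> (\<Union>a\<in>I. biclique (X a) {Pos (v a)} \<union> biclique {Neg (v a)} (Y a)) = {}"
  proof -
    have "C \<notin> F" if "a \<in> I" "C \<in> biclique (X a) {Pos (v a)} \<union> biclique {Neg (v a)} (Y a)" for a C
    proof -
      have "v a \<in> clause_vars C" using that(2) by (auto simp: biclique_def clause_vars_def)
      moreover have "v a \<notin> vars F" using v(2) S(2) that(1) by auto
      ultimately show ?thesis by (auto simp: vars_def)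
    qed
    then show ?thesis using PF by blast
  qed
  have "G w (insert b I) = (G v I - ?P) \<union> biclique (X b) {Pos y} \<union> biclique {Neg y} (Y b)"
  proof -
    have 1: "(\<Union>a\<in>I. biclique (X a) {Pos (w a)} \<union> biclique {Neg (w a)} (Y a)) =
      (\<Union>a\<in>I. biclique (X a) {Pos (v a)} \<union> biclique {Neg (v a)} (Y a))"
      using wI by simp
    have 2: "w b = y" by (simp add: w_def)
    show ?thesis unfolding G_def UN_insert 1 2 using Pnew by blast
  qed
  then have "two_cnf (G w (insert b I))" "bva_step\<^sup>*\<^sup>* F (G w (insert b I))"
    using step v(4) by auto
  moreover have "inj_on w (insert b I)" "w ` insert b I \<inter> S = {}"
    using v(1,2) y insert.hyps(2) by (auto simp: w_def inj_on_def)
  ultimately show ?case unfolding G_def Let_def by blast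
qed

section \<open>Topological order, pairing within groups, number of row patterns\<close>

text \<open>On the finite set \<open>V\<close> the converse of \<open>r\<close> is well-founded; a
  minimal element is a vertex without outgoing edges in \<open>V\<close>, and it can take the last
  number.\<close>

lemma topological_numbering:
  assumes "finite V" "acyclic r"
  shows "\<exists>x. bij_betw x {..<card V} V \<and> (\<forall>i<card V. \<forall>j<card V. (x i, x j) \<in> r \<longrightarrow> i < j)"
  using assms(1)
proof (induction "card V" arbitrary: V)
  case 0
  then show ?case by (auto simp: bij_betw_def)
next
  case (Suc n)
  let ?r = "(r \<inter> V \<times> V)\<inverse>"
  have "finite ?r" using Suc.prems by simp
  moreover have "acyclic ?r" using assms(2) by (metis acyclic_converse acyclic_subset inf_le1)
  ultimately have "wf ?r" by (rule finite_acyclic_wf)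
  moreover obtain z0 where "z0 \<in> V" using Suc by fastforce
  ultimately obtain z where z: "z \<in> V" "\<And>y. (y, z) \<in> ?r \<Longrightarrow> y \<notin> V"
    by (meson wf_eq_minimal)
  have card: "card (V - {z}) = n" using Suc.hyps(2) z(1) by (simp add: Suc.prems)
  then obtain x where x: "bij_betw x {..<n} (V - {z})"
      "\<And>i j. i < n \<Longrightarrow> j < n \<Longrightarrow> (x i, x j) \<in> r \<Longrightarrow> i < j"
    using Suc.hyps(1)[of "V - {z}"] Suc.prems by auto
  define x' where "x' = x(n := z)"
  have bij: "bij_betw x' {..<Suc n} V"
  proof -
    have "bij_betw x' {..<n} (V - {z})"
      using x(1) by (rule bij_betw_cong[THEN iffD1, rotated]) (simp add: x'_def)
    then have "bij_betw x' ({..<n} \<union> {n}) ((V - {z}) \<union> {z})"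
      using bij_betw_combine[of x' "{..<n}" "V - {z}" "{n}" "{z}"] by (simp add: x'_def bij_betw_def)
    moreover have "(V - {z}) \<union> {z} = V" using z by blast
    ultimately show ?thesis by (simp add: lessThan_Suc)
  qed
  moreover have "i < j" if "i < Suc n" "j < Suc n" "(x' i, x' j) \<in> r" for i j
  proof (cases "i = n")
    case True
    then have "(z, x' j) \<in> r" using that by (simp add: x'_def)
    moreover have "x' j \<in> V" using that(2) bij by (simp add: bij_betw_apply)
    ultimately show ?thesis using z by blast
  next
    case False
    then show ?thesis using that x(2) by (cases "j = n") (auto simp: x'_def)
  qed
  ultimately show ?case unfolding Suc.hyps(2)[symmetric] by blast
qed

text \<open>Greedy pairing: as long as two remaining elements agree under \<open>h\<close>, pair
  them. At the end \<open>h\<close> is injective on the leftovers, so each value leaves at most one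
  element over.\<close>

lemma matching_within_groups:
  fixes h :: "'a \<Rightarrow> 'b"
  assumes "finite R"
  shows "\<exists>M. (\<forall>p\<in>M. \<exists>i j. p = {i, j} \<and> i \<in> R \<and> j \<in> R \<and> i \<noteq> j \<and> h i = h j) \<and> disjoint M
    \<and> finite M \<and> 2 * card M + card (R - \<Union>M) = card R \<and> card (R - \<Union>M) \<le> card (h ` R)"
  using assms
proof (induction R rule: finite_psubset_induct)
  case (psubset R)
  show ?case
  proof (cases "inj_on h R")
    case True
    then show ?thesis by (intro exI[of _ "{}"]) (simp add: card_image)
  next
    case False
    then obtain i j where ij: "i \<in> R" "j \<in> R" "i \<noteq> j" "h i = h j" by (auto simp: inj_on_def)
    let ?R = "R - {i, j}"
    have "?R \<subset> R" using ij by blast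
    from psubset.IH[OF this] obtain M where
      M: "\<forall>p\<in>M. \<exists>i j. p = {i, j} \<and> i \<in> ?R \<and> j \<in> ?R \<and> i \<noteq> j \<and> h i = h j" "disjoint M"
         "finite M" "2 * card M + card (?R - \<Union>M) = card ?R" "card (?R - \<Union>M) \<le> card (h ` ?R)" by auto
    have UM: "\<Union>M \<subseteq> ?R"
    proof (rule Union_least)
      fix p assume "p \<in> M"
      then obtain a b where "p = {a, b}" "a \<in> ?R" "b \<in> ?R" using M(1) by metis
      then show "p \<subseteq> ?R" by simp
    qed
    then have new: "{i, j} \<notin> M" by auto
    have eq: "R - \<Union>(insert {i, j} M) = ?R - \<Union>M" by auto
    have cR: "card ?R + 2 = card R"
    proof -
      have "card R = card ?R + card {i, j}"
        using ij psubset.hyps card_Un_disjoint[of ?R "{i, j}"] by (simp add: insert_absorb Un_commute)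
      then show ?thesis using ij by simp
    qed
    have "card (h ` ?R) \<le> card (h ` R)" using psubset.hyps by (intro card_mono) auto
    moreover have "disjoint (insert {i, j} M)"
      using M(2) UM by (auto simp: disjoint_def)
    moreover have "\<forall>p\<in>insert {i, j} M. \<exists>i j. p = {i, j} \<and> i \<in> R \<and> j \<in> R \<and> i \<noteq> j \<and> h i = h j"
    proof (rule ballI)
      fix p assume "p \<in> insert {i, j} M"
      then consider "p = {i, j}" | "p \<in> M" by blast
      then show "\<exists>i j. p = {i, j} \<and> i \<in> R \<and> j \<in> R \<and> i \<noteq> j \<and> h i = h j"
        using M(1) ij by cases (metis, metis DiffD1)
    qed
    moreover have "2 * card (insert {i, j} M) + card (R - \<Union>(insert {i, j} M)) = card R"
      unfolding eq using M(3,4) new cR by simp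
    ultimately show ?thesis using M(3,5) eq
      by (intro exI[of _ "insert {i, j} M"] conjI) (simp_all only: finite_insert)
  qed
qed

text \<open>Each variable of \<open>W\<close> is absent from \<open>T\<close>, occurs positively or
  occurs negatively. These three cases are the source of lg 3 in the final constant.\<close>

lemma card_partial_assignments:
  fixes W :: "'v set"
  assumes "finite W"
  defines "P \<equiv> {T. var_of ` T \<subseteq> W \<and> inj_on var_of T}"
  shows "finite P" "card P \<le> 3 ^ card W" "\<And>T. T \<in> P \<Longrightarrow> finite T \<and> card T \<le> card W"
proof -
  \<comment> \<open>\<open>f\<close> decodes a choice function into its set of literals; it is
    enough that the image of \<open>f\<close> covers \<open>P\<close>.\<close>
  define f where "f c = {l. var_of l \<in> W \<and> c (var_of l) = Some l}" for c :: "'v \<Rightarrow> 'v lit option"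
  let ?E = "PiE W (\<lambda>w. {None, Some (Pos w), Some (Neg w)})"
  have "card ?E = 3 ^ card W" "finite ?E"
    using assms(1) by (auto simp: card_PiE numeral_3_eq_3 intro!: finite_PiE)
  moreover have "P \<subseteq> f ` ?E"
  proof
    fix T assume T: "T \<in> P"
    define c where "c = (\<lambda>w\<in>W. if Pos w \<in> T then Some (Pos w) else if Neg w \<in> T then Some (Neg w) else None)"
    have "c \<in> ?E" by (auto simp: c_def)
    moreover have "f c = T"
    proof (intro set_eqI)
      fix l
      show "l \<in> f c \<longleftrightarrow> l \<in> T"
      proof (cases l)
        case (Pos w) then show ?thesis using T by (auto simp: f_def c_def P_def)
      next
        case (Neg w)
        have "\<not> (Pos w \<in> T \<and> Neg w \<in> T)" using T
          by (auto simp: P_def inj_on_def) (metis lit.distinct(1) var_of.simps)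
        then show ?thesis using T Neg by (auto simp: f_def c_def P_def)
      qed
    qed
    ultimately show "T \<in> f ` ?E" by blast
  qed
  ultimately show "finite P" "card P \<le> 3 ^ card W"
    using finite_surj[of ?E P f] surj_card_le[of ?E P f] by simp_all
  fix T assume "T \<in> P"
  then show "finite T \<and> card T \<le> card W"
    using card_inj_on_le[of var_of T W] finite_imageD[of var_of T] finite_subset[of "var_of ` T" W] assms(1)
    by (simp add: P_def)
qed
text \<open>A cycle of implications through \<open>u\<close> and \<open>w\<close> would make
  \<open>Pos u\<close> and \<open>Pos w\<close> equivalent, so the implications can be numbered
  upwards. A clause with two negative literals fits either order of its variables.\<close>

lemma simple_two_cnf_ordering:
  assumes simple: "simple_two_cnf F"
  shows "\<exists>x. bij_betw x {..<card (vars F)} (vars F) \<and>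
    (\<forall>C\<in>F. \<exists>i j L. i < j \<and> j < card (vars F) \<and> var_of L = x j \<and> C = {Neg (x i), L})"
proof -
  have two: "two_cnf F" using simple by (simp add: simple_two_cnf_def)
  define r where "r = {(u, w). {Neg u, Pos w} \<in> F}"
  have imp: "\<alpha> w" if "(u, w) \<in> r\<^sup>*" "satisfies \<alpha> F" "\<alpha> u" for \<alpha> u w
    using that(1)
  proof induction
    case base show ?case by fact
  next
    case (step y z)
    then have "{Neg y, Pos z} \<in> F" by (simp add: r_def)
    then have "\<exists>l\<in>{Neg y, Pos z}. lit_true \<alpha> l" using that(2) unfolding satisfies_def by blast
    then show ?case using step.IH by simp
  qed
  have "acyclic r"
    unfolding acyclic_def
  proof (intro allI notI)
    fix u assume "(u, u) \<in> r\<^sup>+"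
    then obtain w where w: "(u, w) \<in> r" "(w, u) \<in> r\<^sup>*" by (meson tranclD)
    then have "{Neg u, Pos w} \<in> F" by (simp add: r_def)
    then obtain l m where "{Neg u, Pos w} = {l, m}" "var_of l \<noteq> var_of m"
      using two_cnf_clauseE[OF two] by metis
    \<comment> \<open>Excludes a loop at \<open>u\<close>, so that the two equivalent literals are
      distinct.\<close>
    then have "u \<noteq> w" by (auto simp: doubleton_eq_iff)
    moreover have "entails_equiv F (Pos u) (Pos w)"
      unfolding entails_equiv_def using imp[OF w(2)] imp[OF r_into_rtrancl[OF w(1)]] by auto
    ultimately show False using simple unfolding simple_two_cnf_def by (metis lit.inject(1))
  qed
  then obtain x where x: "bij_betw x {..<card (vars F)} (vars F)"
      "\<And>i j. i < card (vars F) \<Longrightarrow> j < card (vars F) \<Longrightarrow> (x i, x j) \<in> r \<Longrightarrow> i < j"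
    using topological_numbering[OF finite_vars[OF two]] by metis
  have "\<exists>i j L. i < j \<and> j < card (vars F) \<and> var_of L = x j \<and> C = {Neg (x i), L}" if C: "C \<in> F" for C
  proof -
    have "\<forall>C\<in>F. \<exists>x. Neg x \<in> C" using simple unfolding simple_two_cnf_def by (elim conjE)
    then obtain u where u: "Neg u \<in> C" using C by metis
    obtain l m where lm: "C = {l, m}" "var_of l \<noteq> var_of m"
      using two_cnf_clauseE[OF two C] .
    obtain L where L: "C = {Neg u, L}" "var_of L \<noteq> u"
    proof (cases "l = Neg u")
      case True then show ?thesis using that[of m] lm by auto
    next
      case False
      then have "m = Neg u" using u lm by auto
      then show ?thesis using that[of l] lm by auto
    qed
    have "clause_vars C = {u, var_of L}" using L(1) by (simp add: clause_vars_def)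
    moreover have "clause_vars C \<subseteq> vars F" using C unfolding vars_def by (rule UN_upper)
    ultimately have "u \<in> vars F" "var_of L \<in> vars F" by simp_all
    then obtain i j where ij: "i < card (vars F)" "j < card (vars F)" "u = x i" "var_of L = x j"
      using bij_betw_imp_surj_on[OF x(1)] by (metis imageE lessThan_iff)
    show ?thesis
    proof (cases "i < j")
      case True then show ?thesis using ij L by blast
    next
      case False
      then have "j < i" using ij L(2) by (metis linorder_neqE_nat)
      \<comment> \<open>\<open>C\<close> runs against the order, so it cannot be an implication from
        \<open>x i\<close> to \<open>x j\<close>; both literals are negative and the indices swap
        roles.\<close>
      have "L = Neg (x j)"
      proof (cases L)
        case (Pos w)
        then have "(x i, x j) \<in> r" using C L ij by (simp add: r_def)
        then show ?thesis using x(2) ij False by blast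
      qed (use ij in simp)
      then have "C = {Neg (x j), Neg (x i)}" using L ij by auto
      then show ?thesis using \<open>j < i\<close> ij(1) by (metis var_of.simps(2))
    qed
  qed
  then show ?thesis using x(1) by blast
qed

section \<open>The two rounds of BVA steps and the clause count\<close>

lemma card_biclique_singleton:
  assumes "finite X"
  shows "card (biclique X {l}) \<le> card X" "card (biclique {l} X) \<le> card X"
proof -
  have "biclique X {l} = (\<lambda>m. {m, l}) ` X" "biclique {l} X = (\<lambda>m. {l, m}) ` X"
    by (auto simp: biclique_def)
  then show "card (biclique X {l}) \<le> card X" "card (biclique {l} X) \<le> card X"
    using assms by (simp_all add: card_image_le)
qed

text \<open>A pair is coded by one member and the offset of the other in their common group of size
  \<open>g\<close>. The code also covers singletons, the case \<open>i = j\<close>.\<close>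

lemma card_pairs_within_groups:
  fixes n g :: nat
  assumes "g > 0"
  defines "P \<equiv> {{i, j} | i j. i < n \<and> j < n \<and> i div g = j div g}"
  shows "finite P" "card P \<le> n * g"
proof -
  define f where "f = (\<lambda>(i, r). {i, i div g * g + r})"
  have sub: "P \<subseteq> f ` ({..<n} \<times> {..<g})"
  proof
    fix p assume "p \<in> P"
    then obtain i j where ij: "p = {i, j}" "i < n" "i div g = j div g" unfolding P_def by blast
    have "j = i div g * g + j mod g" by (simp add: ij(3))
    then have "p = f (i, j mod g)" using ij(1) by (simp add: f_def)
    moreover have "(i, j mod g) \<in> {..<n} \<times> {..<g}" using ij(2) assms(1) by simp
    ultimately show "p \<in> f ` ({..<n} \<times> {..<g})" by (rule image_eqI)
  qed
  show "finite P" by (rule finite_surj[OF _ sub]) simp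
  have "card P \<le> card ({..<n} \<times> {..<g})" by (rule surj_card_le[OF _ sub]) simp
  then show "card P \<le> n * g" by simp
qed

lemma two_times_sum_mult: "2 * (\<Sum>t<Suc q. t * k) = k * q * (q + 1)" for k q :: nat
  by (induction q) (auto simp: algebra_simps)

text \<open>The factor 4 clears two halves, one from pairing rows and one from the triangle. The
  summands pay, in order, for clauses with row and column in one strip, links from pattern variables
  to their literals, links from rows to pair variables, half a clause per row and strip, and the
  extra half clause of each unpaired row.\<close>

lemma simple_two_cnf_compress:
  fixes F :: "'v::infinite formula"
  assumes simple: "simple_two_cnf F" and n: "card (vars F) = n" and k: "k > 0" and g: "g > 0"
  defines "q \<equiv> n div k"
  shows "\<exists>F'. two_cnf F' \<and> bva_step\<^sup>*\<^sup>* F F' \<and>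
    4 * card F' \<le> 8 * n * k + 4 * ((q + 1) * 3 ^ k) * k + 8 * n * g + n * (q + 1)
      + 2 * ((q + 1) * 3 ^ k) * (n div g + 1)"
proof -
  have two: "two_cnf F" using simple by (simp add: simple_two_cnf_def)
  have finF: "finite F" "finite (vars F)" using two finite_vars by (auto simp: two_cnf_iff)
  obtain x where bij: "bij_betw x {..<n} (vars F)"
    and form: "\<And>C. C \<in> F \<Longrightarrow> \<exists>i j L. i < j \<and> j < n \<and> var_of L = x j \<and> C = {Neg (x i), L}"
    using simple_two_cnf_ordering[OF simple] unfolding n by blast
  have xV: "x i \<in> vars F" if "i < n" for i using bij that by (simp add: bij_betw_apply)
  have xinj: "x i = x j \<Longrightarrow> i = j" if "i < n" "j < n" for i j
    using bij that unfolding bij_betw_def inj_on_def by blast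
  \<comment> \<open>One more than \<open>q\<close>, since the columns from \<open>q * k\<close> on
    form a last incomplete strip, possibly empty. \<open>A\<close> then lists every strip with all
    its conceivable patterns.\<close>
  define m where "m = q + 1"
  define blk where "blk t = {j. j < n \<and> j div k = t}" for t
  define Pat where "Pat t = {T. var_of ` T \<subseteq> x ` blk t \<and> inj_on var_of T}" for t
  define A where "A = Sigma {..<m} Pat"
  define row where "row t i = {L. var_of L \<in> x ` blk t \<and> {Neg (x i), L} \<in> F}" for t i
  \<comment> \<open>With \<open>i < fst a * k\<close> every column of the strip lies to the right of
    the diagonal in row \<open>i\<close>. The rows of the diagonal block itself are left to
    \<open>N\<close> below.\<close>
  define R where "R a = {i. i < fst a * k \<and> i < n \<and> row (fst a) i = snd a}" for a :: "nat \<times> 'v lit set"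
  define nx where "nx = (\<lambda>i. Neg (x i))"

  have fin_blk: "finite (blk t)" "card (blk t) \<le> k" for t
  proof -
    have "blk t \<subseteq> {t * k..<t * k + k}"
    proof
      fix j assume "j \<in> blk t"
      then have "j = t * k + j mod k" "j mod k < k" using k by (auto simp: blk_def)
      then show "j \<in> {t * k..<t * k + k}" by (metis atLeastLessThan_iff le_add1 nat_add_left_cancel_less)
    qed
    then show "finite (blk t)" "card (blk t) \<le> k"
      using finite_subset card_mono[of "{t * k..<t * k + k}" "blk t"] by auto
  qed
  have Pat: "finite (Pat t)" "card (Pat t) \<le> 3 ^ k" "\<And>T. T \<in> Pat t \<Longrightarrow> finite T \<and> card T \<le> k" for t
  proof -
    have fin: "finite (x ` blk t)" and c: "card (x ` blk t) \<le> k"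
      using fin_blk[of t] card_image_le[of "blk t" x] by auto
    show "finite (Pat t)" using card_partial_assignments(1)[OF fin] by (simp add: Pat_def)
    have "card (Pat t) \<le> 3 ^ card (x ` blk t)"
      using card_partial_assignments(2)[OF fin] by (simp add: Pat_def)
    also have "\<dots> \<le> 3 ^ k" using c by (simp add: power_increasing)
    finally show "card (Pat t) \<le> 3 ^ k" .
    show "finite T \<and> card T \<le> k" if "T \<in> Pat t" for T
      using card_partial_assignments(3)[OF fin, of T] that c by (simp add: Pat_def)
  qed
  have A: "finite A" "card A \<le> (q + 1) * 3 ^ k"
  proof -
    show "finite A" using Pat(1) by (simp add: A_def)
    have "card A = (\<Sum>t<m. card (Pat t))" using Pat(1) by (simp add: A_def)
    also have "\<dots> \<le> of_nat (card {..<m}) * 3 ^ k" by (intro sum_bounded_above Pat(2))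
    finally show "card A \<le> (q + 1) * 3 ^ k" by (simp add: m_def)
  qed
  have distinct_vars: "\<forall>C1\<in>F. \<forall>C2\<in>F. C1 \<noteq> C2 \<longrightarrow> clause_vars C1 \<noteq> clause_vars C2"
    using simple unfolding simple_two_cnf_def by (elim conjE)
  \<comment> \<open>Condition (c) of simplicity enters here: two literals over one variable in a row
    would give two clauses with the same variables.\<close>
  have row_Pat: "row t i \<in> Pat t" for t i
  proof -
    have "L = L'" if "L \<in> row t i" "L' \<in> row t i" "var_of L = var_of L'" for L L'
    proof -
      have "clause_vars {Neg (x i), L} = clause_vars {Neg (x i), L'}"
        using that(3) by (simp add: clause_vars_def)
      then have "{Neg (x i), L} = {Neg (x i), L'}"
        using that(1,2) distinct_vars unfolding row_def by (metis (mono_tags, lifting) mem_Collect_eq)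
      then show ?thesis by (auto simp: doubleton_eq_iff)
    qed
    then show ?thesis by (auto simp: Pat_def row_def inj_on_def)
  qed
  have finR: "finite (R a)" for a by (simp add: R_def)
  have Rn: "i < n" if "i \<in> R a" for i a using that by (simp add: R_def)
  have RF: "{nx i, L} \<in> F" if "i \<in> R a" "L \<in> snd a" for a i L
    using that by (auto simp: R_def row_def nx_def)
  have Rcol: "\<exists>j. i < j \<and> j < n \<and> j div k = fst a \<and> var_of L = x j" if "i \<in> R a" "L \<in> snd a" for a i L
  proof -
    have "L \<in> row (fst a) i" "i < fst a * k" using that by (auto simp: R_def)
    then obtain j where j: "j < n" "j div k = fst a" "var_of L = x j" by (auto simp: row_def blk_def)
    have "fst a * k \<le> j" using j(2) by (metis div_times_less_eq_dividend)
    then show ?thesis using j \<open>i < fst a * k\<close> by (intro exI[of _ j]) simp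
  qed
  \<comment> \<open>A clause determines its row and its column, hence its strip and pattern. Reading
    it the other way round would exchange row and column, against \<open>i < j\<close> and
    \<open>i' < j'\<close>.\<close>
  have disj1: "disjoint_family_on (\<lambda>a. biclique (nx ` R a) (snd a)) A"
    unfolding disjoint_family_on_def
  proof (intro ballI impI equals0I)
    fix a b C assume "a \<noteq> b" "C \<in> biclique (nx ` R a) (snd a) \<inter> biclique (nx ` R b) (snd b)"
    then obtain i L i' L' where 1: "C = {nx i, L}" "i \<in> R a" "L \<in> snd a" "C = {nx i', L'}" "i' \<in> R b" "L' \<in> snd b"
      unfolding biclique_def by blast
    obtain j where j: "i < j" "j < n" "j div k = fst a" "var_of L = x j" using Rcol 1 by blast
    obtain j' where j': "i' < j'" "j' < n" "j' div k = fst b" "var_of L' = x j'" using Rcol 1 by blast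
    have in': "i < n" "i' < n" using Rn 1 by blast+
    have "nx i = nx i' \<and> L = L' \<or> nx i = L' \<and> L = nx i'"
      using 1(1,4) unfolding doubleton_eq_iff[symmetric] by simp
    then have "i = i' \<and> j = j'"
    proof
      assume "nx i = nx i' \<and> L = L'"
      then show ?thesis using xinj in' j j' by (auto simp: nx_def)
    next
      assume "nx i = L' \<and> L = nx i'"
      then have "x i = x j'" "x j = x i'" using j(4) j'(4) by (auto simp: nx_def)
      then have "i = j'" "j = i'" using xinj in' j(2) j'(2) by blast+
      then show ?thesis using j(1) j'(1) by simp
    qed
    then have "fst a = fst b" "snd a = snd b" using 1(2,5) j(3) j'(3) by (auto simp: R_def)
    then show False using \<open>a \<noteq> b\<close> by (simp add: prod_eq_iff)
  qed
  have sub1: "biclique (nx ` R a) (snd a) \<subseteq> F" for a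
    using RF[of _ a] unfolding biclique_def by blast
  have A_snd: "finite (snd a)" "card (snd a) \<le> k" "var_of ` snd a \<subseteq> vars F" if "a \<in> A" for a
  proof -
    have "snd a \<in> Pat (fst a)" using that by (auto simp: A_def)
    then show "finite (snd a)" "card (snd a) \<le> k" "var_of ` snd a \<subseteq> vars F"
      using Pat(3) xV by (auto simp: Pat_def blk_def)
  qed
  have var_nx: "var_of ` nx ` R a \<subseteq> vars F" for a
  proof -
    have "var_of ` nx ` R a = x ` R a" by (simp add: nx_def image_image)
    then show ?thesis using Rn[of _ a] xV by (simp add: image_subset_iff)
  qed
  \<comment> \<open>First round: the variable \<open>v a\<close> stands for the pattern
    \<open>snd a\<close>. Each row with this pattern implies \<open>v a\<close>, and
    \<open>v a\<close> implies the literals of the pattern.\<close>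
  define F1 where "F1 v = (F - (\<Union>a\<in>A. biclique (nx ` R a) (snd a)))
      \<union> (\<Union>a\<in>A. biclique (nx ` R a) {Pos (v a)} \<union> biclique {Neg (v a)} (snd a))" for v
  have "\<exists>v. inj_on v A \<and> v ` A \<inter> vars F = {} \<and> two_cnf (F1 v) \<and> bva_step\<^sup>*\<^sup>* F (F1 v)"
    using bva_family[OF A(1) two finF(2) order_refl, of "\<lambda>a. nx ` R a" snd] sub1 disj1 A_snd finR var_nx
    unfolding F1_def Let_def image_Un by simp
  then obtain v where v: "inj_on v A" "v ` A \<inter> vars F = {}" "two_cnf (F1 v)" "bva_step\<^sup>*\<^sup>* F (F1 v)"
    by blast

  \<comment> \<open>Rows linked to the same \<open>v a\<close> are paired, but only within groups of
    size \<open>g\<close>. This keeps the number of different pairs over all \<open>a\<close> below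
    \<open>n * g\<close>, so that a variable for each pair is affordable.\<close>
  have "\<forall>a. \<exists>M. (\<forall>p\<in>M. \<exists>i j. p = {i, j} \<and> i \<in> R a \<and> j \<in> R a \<and> i \<noteq> j \<and> i div g = j div g) \<and> disjoint M
    \<and> finite M \<and> 2 * card M + card (R a - \<Union>M) = card (R a) \<and> card (R a - \<Union>M) \<le> card ((\<lambda>i. i div g) ` R a)"
    by (intro allI matching_within_groups finR)
  then obtain M where
    M: "\<And>a p. p \<in> M a \<Longrightarrow> \<exists>i j. p = {i, j} \<and> i \<in> R a \<and> j \<in> R a \<and> i \<noteq> j \<and> i div g = j div g"
    and Mdisj: "\<And>a. disjoint (M a)"
    and Mcard: "\<And>a. 2 * card (M a) + card (R a - \<Union>(M a)) = card (R a)"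
    and Mleft: "\<And>a. card (R a - \<Union>(M a)) \<le> card ((\<lambda>i. i div g) ` R a)"
    by metis
  define P where "P = {{i, j} | i j. i < n \<and> j < n \<and> i div g = j div g}"
  have P: "finite P" "card P \<le> n * g" using card_pairs_within_groups[OF g] by (auto simp: P_def)
  have MP: "M a \<subseteq> P" for a
  proof
    fix p assume "p \<in> M a"
    then obtain i j where "p = {i, j}" "i \<in> R a" "j \<in> R a" "i div g = j div g" using M by metis
    then show "p \<in> P" unfolding P_def using Rn by blast
  qed
  have MR: "p \<subseteq> R a" if "p \<in> M a" for p a using M[OF that] by auto
  have Pfin: "finite p \<and> card p \<le> 2 \<and> p \<subseteq> {..<n}" if "p \<in> P" for p
    using that by (auto simp: P_def card_insert_if)
  \<comment> \<open>All pattern variables to which both rows of \<open>p\<close> are linked through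
    a matching. The step for \<open>p\<close> turns \<open>2 * card (Y p)\<close> clauses into
    \<open>2 + card (Y p)\<close>. If \<open>p\<close> lies in no matching, \<open>Y p\<close> is
    empty and the step only adds clauses, which \<open>?U3\<close> counts.\<close>
  define Y where "Y p = (\<lambda>a. Pos (v a)) ` {a\<in>A. p \<in> M a}" for p
  have sub2: "biclique (nx ` p) (Y p) \<subseteq> F1 v" for p
  proof
    fix C assume "C \<in> biclique (nx ` p) (Y p)"
    then obtain i a where ia: "i \<in> p" "a \<in> A" "p \<in> M a" "C = {nx i, Pos (v a)}"
      unfolding biclique_def Y_def by blast
    then have "C \<in> biclique (nx ` R a) {Pos (v a)}" using MR unfolding biclique_def by blast
    then show "C \<in> F1 v" using ia(2) unfolding F1_def by blast
  qed
  \<comment> \<open>A link clause determines its row \<open>i\<close> and its \<open>a\<close>, and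
    only one pair of the matching \<open>M a\<close> contains \<open>i\<close>.\<close>
  have disj2: "disjoint_family_on (\<lambda>p. biclique (nx ` p) (Y p)) P"
    unfolding disjoint_family_on_def
  proof (intro ballI impI equals0I)
    fix p p' C assume "p \<in> P" "p' \<in> P" "p \<noteq> p'" "C \<in> biclique (nx ` p) (Y p) \<inter> biclique (nx ` p') (Y p')"
    then obtain i a i' a' where 1: "i \<in> p" "a \<in> A" "p \<in> M a" "C = {nx i, Pos (v a)}"
      "i' \<in> p'" "a' \<in> A" "p' \<in> M a'" "C = {nx i', Pos (v a')}"
      unfolding biclique_def Y_def by blast
    have "nx i = nx i'" "v a = v a'" using 1(4,8) by (auto simp: doubleton_eq_iff nx_def)
    moreover have "i < n" "i' < n" using Pfin 1(1,5) \<open>p \<in> P\<close> \<open>p' \<in> P\<close> by blast+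
    ultimately have "i = i'" "a = a'" using xinj v(1) 1(2,6) by (auto simp: nx_def inj_on_def)
    then have "p \<inter> p' \<noteq> {}" "p \<in> M a" "p' \<in> M a" using 1 by auto
    then show False using Mdisj[of a] \<open>p \<noteq> p'\<close> unfolding disjoint_def by blast
  qed
  define S where "S = vars (F1 v) \<union> vars F \<union> v ` A"
  have S: "finite S" "vars (F1 v) \<subseteq> S" using finite_vars[OF v(3)] finF(2) A(1) by (auto simp: S_def)
  have Yfin: "finite (nx ` p) \<and> finite (Y p) \<and> var_of ` (nx ` p \<union> Y p) \<subseteq> S" if "p \<in> P" for p
    using Pfin[OF that] A(1) xV by (auto simp: Y_def S_def nx_def)
  define F2 where "F2 w = (F1 v - (\<Union>p\<in>P. biclique (nx ` p) (Y p)))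
      \<union> (\<Union>p\<in>P. biclique (nx ` p) {Pos (w p)} \<union> biclique {Neg (w p)} (Y p))" for w
  have "\<exists>w. two_cnf (F2 w) \<and> bva_step\<^sup>*\<^sup>* (F1 v) (F2 w)"
    using bva_family[OF P(1) v(3) S, of "\<lambda>p. nx ` p" Y, OF Yfin sub2 disj2] unfolding F2_def Let_def by blast
  then obtain w where w: "two_cnf (F2 w)" "bva_step\<^sup>*\<^sup>* (F1 v) (F2 w)" by blast

  \<comment> \<open>Room for all clauses with row and column in one strip: \<open>k\<close> columns
    and two signs per row. In the last strip the column index may exceed \<open>n\<close>, which is
    harmless in an upper bound.\<close>
  define N where "N = (\<lambda>(i, r, s). {nx i, (if s then Pos else Neg) (x (i div k * k + r))}) ` ({..<n} \<times> {..<k} \<times> (UNIV :: bool set))"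
  have N: "finite N" "card N \<le> 2 * n * k"
  proof -
    show "finite N" by (simp add: N_def)
    have "card N \<le> card ({..<n} \<times> {..<k} \<times> (UNIV :: bool set))" unfolding N_def by (rule card_image_le) simp
    then show "card N \<le> 2 * n * k" by (simp add: card_cartesian_product mult_ac)
  qed
  have FN: "F \<subseteq> N \<union> (\<Union>a\<in>A. biclique (nx ` R a) (snd a))"
  proof
    fix C assume C: "C \<in> F"
    then obtain i j L where ijL: "i < j" "j < n" "var_of L = x j" "C = {Neg (x i), L}" using form by blast
    show "C \<in> N \<union> (\<Union>a\<in>A. biclique (nx ` R a) (snd a))"
    proof (cases "i div k = j div k")
      case True
      then have "i div k * k + j mod k = j" by simp
      moreover have "L = (if L = Pos (x j) then Pos else Neg) (x j)" using ijL(3) by (cases L) auto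
      ultimately have "C = {nx i, (if L = Pos (x j) then Pos else Neg) (x (i div k * k + j mod k))}"
        using ijL(4) by (simp add: nx_def)
      then have "C \<in> N" unfolding N_def
        using ijL(1,2) k by (intro image_eqI[of _ _ "(i, j mod k, L = Pos (x j))"]) auto
      then show ?thesis by blast
    next
      case False
      define a where "a = (j div k, row (j div k) i)"
      have "i div k < j div k" using False ijL(1) by (simp add: div_le_mono order_neq_le_trans)
      then have "i < j div k * k" using k by (simp add: div_less_iff_less_mult)
      then have "i \<in> R a" using ijL(1,2) by (simp add: R_def a_def)
      moreover have "L \<in> snd a" using C ijL by (auto simp: a_def row_def blk_def)
      moreover have "j div k < m" using ijL(2) by (simp add: m_def q_def div_le_mono less_Suc_eq_le)
      then have "a \<in> A" using row_Pat by (simp add: A_def a_def)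
      ultimately show ?thesis using ijL(4) unfolding biclique_def nx_def by blast
    qed
  qed
  \<comment> \<open>Links from unpaired rows to pattern variables, from patterns to literals, from
    rows to pair variables, and from pairs to patterns. Direct links of paired rows are gone after
    the second round.\<close>
  let ?U1 = "\<Union>a\<in>A. biclique (nx ` (R a - \<Union>(M a))) {Pos (v a)}"
  let ?U2 = "\<Union>a\<in>A. biclique {Neg (v a)} (snd a)"
  let ?U3 = "\<Union>p\<in>P. biclique (nx ` p) {Pos (w p)}"
  let ?U4 = "\<Union>p\<in>P. biclique {Neg (w p)} (Y p)"
  have cover: "F2 w \<subseteq> N \<union> ?U1 \<union> ?U2 \<union> ?U3 \<union> ?U4"
  proof
    fix C assume "C \<in> F2 w"
    then consider "C \<in> ?U3 \<union> ?U4" | "C \<in> F1 v" "C \<notin> (\<Union>p\<in>P. biclique (nx ` p) (Y p))"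
      unfolding F2_def by blast
    then show "C \<in> N \<union> ?U1 \<union> ?U2 \<union> ?U3 \<union> ?U4"
    proof cases
      case 2
      then consider "C \<in> N \<union> ?U2" | a where "a \<in> A" "C \<in> biclique (nx ` R a) {Pos (v a)}"
        using FN unfolding F1_def by blast
      then show ?thesis
      proof cases
        case (2 a)
        then obtain i where i: "i \<in> R a" "C = {nx i, Pos (v a)}" unfolding biclique_def by blast
        have "i \<notin> \<Union>(M a)"
        proof
          assume "i \<in> \<Union>(M a)"
          then obtain p where p: "p \<in> M a" "i \<in> p" by blast
          then have "Pos (v a) \<in> Y p" using \<open>a \<in> A\<close> unfolding Y_def by blast
          then have "C \<in> biclique (nx ` p) (Y p)" using i(2) p(2) unfolding biclique_def by blast
          moreover have "p \<in> P" using MP p(1) by blast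
          ultimately show False using \<open>C \<notin> (\<Union>p\<in>P. biclique (nx ` p) (Y p))\<close> by blast
        qed
        then have "C \<in> biclique (nx ` (R a - \<Union>(M a))) {Pos (v a)}" using i unfolding biclique_def by blast
        then show ?thesis using \<open>a \<in> A\<close> by blast
      qed blast
    qed blast
  qed
  have U1: "card ?U1 \<le> (\<Sum>a\<in>A. card (R a - \<Union>(M a)))" "finite ?U1"
  proof -
    have "card (biclique (nx ` (R a - \<Union>(M a))) {Pos (v a)}) \<le> card (R a - \<Union>(M a))" for a
      using card_biclique_singleton(1)[of "nx ` (R a - \<Union>(M a))" "Pos (v a)"] card_image_le[of "R a - \<Union>(M a)" nx] finR
      by (meson finite_Diff finite_imageI order_trans)
    then show "card ?U1 \<le> (\<Sum>a\<in>A. card (R a - \<Union>(M a)))"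
      by (intro order_trans[OF card_UN_le[OF A(1)]] sum_mono)
    show "finite ?U1" using A(1) finR by (auto intro!: finite_biclique)
  qed
  have U2: "card ?U2 \<le> card A * k" "finite ?U2"
  proof -
    have "card ?U2 \<le> (\<Sum>a\<in>A. card (biclique {Neg (v a)} (snd a)))" by (rule card_UN_le[OF A(1)])
    also have "\<dots> \<le> of_nat (card A) * k"
    proof (rule sum_bounded_above)
      fix a assume "a \<in> A"
      show "card (biclique {Neg (v a)} (snd a)) \<le> k"
        using card_biclique_singleton(2)[OF A_snd(1)[OF \<open>a \<in> A\<close>], of "Neg (v a)"] A_snd(2)[OF \<open>a \<in> A\<close>]
        by (rule order_trans)
    qed
    finally show "card ?U2 \<le> card A * k" by simp
    show "finite ?U2" using A(1) A_snd by (auto intro!: finite_biclique)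
  qed
  have U3: "card ?U3 \<le> card P * 2" "finite ?U3"
  proof -
    have "card ?U3 \<le> (\<Sum>p\<in>P. card (biclique (nx ` p) {Pos (w p)}))" by (rule card_UN_le[OF P(1)])
    also have "\<dots> \<le> of_nat (card P) * 2"
    proof (rule sum_bounded_above)
      fix p assume "p \<in> P"
      then have "card (biclique (nx ` p) {Pos (w p)}) \<le> card (nx ` p)" "card (nx ` p) \<le> card p" "card p \<le> 2"
        using Pfin card_biclique_singleton(1)[of "nx ` p"] card_image_le[of p nx] by auto
      then show "card (biclique (nx ` p) {Pos (w p)}) \<le> 2" by linarith
    qed
    finally show "card ?U3 \<le> card P * 2" by simp
    show "finite ?U3" using P(1) Pfin by (auto intro!: finite_biclique)
  qed
  have U4: "card ?U4 \<le> (\<Sum>a\<in>A. card (M a))" "finite ?U4"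
  proof -
    have "card ?U4 \<le> (\<Sum>p\<in>P. card (biclique {Neg (w p)} (Y p)))" by (rule card_UN_le[OF P(1)])
    also have "\<dots> \<le> (\<Sum>p\<in>P. card {a\<in>A. p \<in> M a})"
    proof (rule sum_mono)
      fix p assume "p \<in> P"
      have "card (biclique {Neg (w p)} (Y p)) \<le> card (Y p)"
        using Yfin[OF \<open>p \<in> P\<close>] card_biclique_singleton(2) by blast
      also have "\<dots> \<le> card {a\<in>A. p \<in> M a}" unfolding Y_def using A(1) by (intro card_image_le) simp
      finally show "card (biclique {Neg (w p)} (Y p)) \<le> card {a\<in>A. p \<in> M a}" .
    qed
    \<comment> \<open>Double counting of the incidences \<open>p \<in> M a\<close>.\<close>
    also have "\<dots> = (\<Sum>a\<in>A. card (M a))"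
    proof (rule sum_multicount_gen[OF P(1) A(1)], rule ballI)
      fix a assume "a \<in> A"
      have "{p \<in> P. p \<in> M a} = M a" using MP[of a] by blast
      then show "card {p \<in> P. p \<in> M a} = card (M a)" by simp
    qed
    finally show "card ?U4 \<le> (\<Sum>a\<in>A. card (M a))" .
    show "finite ?U4" using P(1) Yfin by (auto intro!: finite_biclique)
  qed
  \<comment> \<open>Within a strip each row has one pattern, so strip \<open>t\<close> contributes
    at most the \<open>t * k\<close> rows before it. Summing over \<open>t\<close> gives the
    triangle, half of the full rectangle.\<close>
  have sumR: "2 * (\<Sum>a\<in>A. card (R a)) \<le> n * (q + 1)"
  proof -
    have "(\<Sum>T\<in>Pat t. card (R (t, T))) \<le> t * k" for t
    proof -
      have "(\<Sum>T\<in>Pat t. card (R (t, T))) = card (\<Union>T\<in>Pat t. R (t, T))"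
        by (rule card_UN_disjoint[symmetric]) (auto simp: Pat(1) finR, auto simp: R_def)
      also have "\<dots> \<le> card {..<t * k}" by (intro card_mono) (auto simp: R_def)
      finally show ?thesis by simp
    qed
    then have "(\<Sum>t<m. \<Sum>T\<in>Pat t. card (R (t, T))) \<le> (\<Sum>t<m. t * k)" by (rule sum_mono)
    moreover have "(\<Sum>a\<in>A. card (R a)) = (\<Sum>t<m. \<Sum>T\<in>Pat t. card (R (t, T)))"
      unfolding A_def by (subst sum.Sigma) (auto simp: Pat(1))
    ultimately have "2 * (\<Sum>a\<in>A. card (R a)) \<le> 2 * (\<Sum>t<Suc q. t * k)" by (simp add: m_def)
    also have "\<dots> = k * q * (q + 1)" by (rule two_times_sum_mult)
    also have "\<dots> \<le> n * (q + 1)" by (intro mult_right_mono) (simp_all add: q_def)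
    finally show ?thesis .
  qed
  \<comment> \<open>At most one row per group stays unpaired, and row indices below \<open>n\<close>
    lie in groups \<open>0\<close> to \<open>n div g\<close>.\<close>
  have left: "(\<Sum>a\<in>A. card (R a - \<Union>(M a))) \<le> card A * (n div g + 1)"
  proof -
    have "card (R a - \<Union>(M a)) \<le> n div g + 1" for a
    proof -
      have "(\<lambda>i. i div g) ` R a \<subseteq> {..n div g}" using Rn[of _ a] by (auto simp: div_le_mono less_imp_le)
      then have "card ((\<lambda>i. i div g) ` R a) \<le> card {..n div g}" by (intro card_mono) simp
      then show ?thesis using Mleft[of a] by simp
    qed
    then show ?thesis using sum_bounded_above[of A "\<lambda>a. card (R a - \<Union>(M a))" "n div g + 1"] by simp
  qed
  have "card (F2 w) \<le> card (N \<union> ?U1 \<union> ?U2 \<union> ?U3 \<union> ?U4)"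
    using cover N(1) U1(2) U2(2) U3(2) U4(2) by (intro card_mono) simp_all
  also have "\<dots> \<le> card N + card ?U1 + card ?U2 + card ?U3 + card ?U4"
    by (intro order_trans[OF card_Un_le] add_mono order_refl)
  finally have "card (F2 w) \<le> card N + card ?U1 + card ?U2 + card ?U3 + card ?U4" .
  \<comment> \<open>Hence \<open>?U1\<close> and \<open>?U4\<close> together have at most half as
    many clauses as there are rows in all \<open>R a\<close>, plus half the number of unpaired
    rows.\<close>
  moreover have "2 * (\<Sum>a\<in>A. card (M a)) + (\<Sum>a\<in>A. card (R a - \<Union>(M a))) = (\<Sum>a\<in>A. card (R a))"
    using Mcard by (simp add: sum_distrib_left flip: sum.distrib)
  ultimately have "4 * card (F2 w) \<le> 8 * n * k + 4 * (card A * k) + 8 * (n * g) + n * (q + 1)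
      + 2 * (card A * (n div g + 1))"
    using N(2) U1(1) U2(1) U3(1) U4(1) P(2) sumR left by linarith
  moreover have "card A * k \<le> (q + 1) * 3 ^ k * k" "card A * (n div g + 1) \<le> (q + 1) * 3 ^ k * (n div g + 1)"
    using A(2) by (intro mult_right_mono; simp)+
  ultimately have "4 * card (F2 w) \<le> 8 * n * k + 4 * ((q + 1) * 3 ^ k) * k + 8 * n * g + n * (q + 1)
      + 2 * ((q + 1) * 3 ^ k) * (n div g + 1)" by (simp only: mult.assoc)
  moreover have "bva_step\<^sup>*\<^sup>* F (F2 w)" using v(4) w(2) by simp
  ultimately show ?thesis using w(1) by blast
qed

section \<open>Choice of strip width and group size, and asymptotics\<close>

text \<open>Chosen so that there are \<open>3 powr strip_width n = n / (ln n) ^ 4\<close> patterns per strip.\<close>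

definition strip_width :: "real \<Rightarrow> real" where
  "strip_width n = (ln n - 4 * ln (ln n)) / ln 3"

text \<open>
  Four times the number of clauses for strip width about \<open>strip_width n\<close> and row groups of size about
  \<open>n / (ln n)\<^sup>2\<close>; the fourth summand is the dominant one.
\<close>

definition size_bound :: "real \<Rightarrow> real" where
  "size_bound n = 8 * n * strip_width n + 4 * ((n / (strip_width n - 1) + 1) * (n / ln n ^ 4)) * strip_width n
  + 8 * n * (n / ln n ^ 2 + 1) + n * (n / (strip_width n - 1) + 1)
  + 2 * ((n / (strip_width n - 1) + 1) * (n / ln n ^ 4)) * (ln n ^ 2 + 1)"

text \<open>The fourth summand is asymptotic to \<open>ln 3 * n^2 / ln n\<close>. The exponent 2 in
  the group size makes the pair variables negligible, and the exponent 4 in the number of patterns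
  makes the unpaired rows negligible although there are about \<open>ln n ^ 2\<close>
  groups.\<close>

lemma size_bound_tendsto: "(\<lambda>n. size_bound (real n) / 4 * (log 2 (real n) / (real n)\<^sup>2)) \<longlonglongrightarrow> log 2 3 / 4"
proof -
  have "(\<lambda>n. size_bound (real n) / 4 * (log 2 (real n) / (real n)\<^sup>2)) \<longlonglongrightarrow> ln 3 * inverse (ln 2) / 4"
    unfolding size_bound_def strip_width_def log_def by real_asymp
  moreover have "ln 3 * inverse (ln 2) / 4 = log 2 3 / (4 :: real)" unfolding log_def divide_inverse by (rule refl)
  ultimately show ?thesis by (simp only:)
qed

text \<open>These thresholds say what a large \<open>n\<close> is: the first keeps the divisor
  \<open>strip_width n - 1\<close> and the rounded width positive, the second makes
  \<open>ln n\<close> positive.\<close>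

lemma strip_width_eventually: "\<forall>\<^sub>F n in sequentially. strip_width (real n) > 2 \<and> ln (real n) > 1"
  unfolding strip_width_def by (intro eventually_conj; real_asymp)

text \<open>The width is rounded down to keep \<open>3 ^ k\<close> below
  \<open>n / ln n ^ 4\<close>; as \<open>k\<close> also occurs as a divisor, it is bounded below by
  \<open>strip_width n - 1\<close>. The group size is rounded up to keep \<open>n div g\<close>
  below \<open>ln n ^ 2\<close>, at the price of the added 1.\<close>

lemma compressed_size_le_size_bound:
  fixes n k g :: nat
  assumes n: "strip_width (real n) > 2" "ln (real n) > 1"
  defines "k \<equiv> nat \<lfloor>strip_width (real n)\<rfloor>" and "g \<equiv> nat \<lceil>real n / ln (real n) ^ 2\<rceil>"
  defines "q \<equiv> n div k"
  shows "k > 0" "g > 0"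
    "real (8 * n * k + 4 * ((q + 1) * 3 ^ k) * k + 8 * n * g + n * (q + 1)
      + 2 * ((q + 1) * 3 ^ k) * (n div g + 1)) \<le> size_bound (real n)"
proof -
  \<comment> \<open>\<open>n = 0\<close> is excluded by the default value
    \<open>ln 0 = 0\<close>.\<close>
  have npos: "real n > 0" using n(2) by (cases "n = 0") auto
  have lpos: "ln (real n) > 0" using n(2) by linarith
  have k1: "strip_width (real n) - 1 < real k" "real k \<le> strip_width (real n)" using n by (auto simp: k_def)
  show k0: "k > 0" using k1 n by linarith
  have gx: "real n / ln (real n) ^ 2 > 0" by (intro divide_pos_pos zero_less_power npos lpos)
  have g1: "real n / ln (real n) ^ 2 \<le> real g" "real g \<le> real n / ln (real n) ^ 2 + 1"
    using gx by (auto simp: g_def)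
  show g0: "g > 0" using g1(1) gx by linarith
  have q: "real q \<le> real n / (strip_width (real n) - 1)"
  proof -
    have "real q \<le> real n / real k" unfolding q_def by (rule of_nat_div_le_of_nat)
    also have "\<dots> \<le> real n / (strip_width (real n) - 1)" using k1 n by (intro divide_left_mono) auto
    finally show ?thesis .
  qed
  have p: "3 ^ k \<le> real n / ln (real n) ^ 4"
  proof -
    have "(3::real) ^ k = exp (real k * ln 3)" by (simp add: exp_of_nat_mult)
    also have "\<dots> \<le> exp (strip_width (real n) * ln 3)" using k1 by simp
    also have "strip_width (real n) * ln 3 = ln (real n) - 4 * ln (ln (real n))" by (simp add: strip_width_def)
    also have "exp \<dots> = exp (ln (real n)) / exp (real 4 * ln (ln (real n)))" by (simp add: exp_diff)
    also have "\<dots> = real n / ln (real n) ^ 4" using npos lpos by (subst exp_of_nat_mult) simp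
    finally show ?thesis .
  qed
  have d: "real (n div g) \<le> ln (real n) ^ 2"
  proof -
    have "real (n div g) \<le> real n / real g" by (rule of_nat_div_le_of_nat)
    also have "\<dots> \<le> real n / (real n / ln (real n) ^ 2)" 
      by (intro divide_left_mono mult_pos_pos g1(1) gx) (use g0 in simp_all)
    finally show ?thesis using npos by simp
  qed
  have qp: "(real q + 1) * 3 ^ k \<le> (real n / (strip_width (real n) - 1) + 1) * (real n / ln (real n) ^ 4)" (is "?a \<le> ?b")
    using q p n npos by (intro mult_mono add_mono) (auto intro!: add_nonneg_nonneg)
  have mono: "s * a * c \<le> s * b * d" if "a \<le> b" "c \<le> d" "0 \<le> a" "0 \<le> c" "0 \<le> s" for s a b c d :: real
    using that by (intro mult_mono) auto
  have "8 * real n * real k \<le> 8 * real n * strip_width (real n)" using k1 by (intro mult_left_mono) auto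
  moreover have "4 * ?a * real k \<le> 4 * ?b * strip_width (real n)" by (rule mono[OF qp k1(2)]) simp_all
  moreover have "8 * real n * real g \<le> 8 * real n * (real n / ln (real n) ^ 2 + 1)" using g1 by (intro mult_left_mono) auto
  moreover have "real n * (real q + 1) \<le> real n * (real n / (strip_width (real n) - 1) + 1)" using q by (intro mult_left_mono) auto
  moreover have "2 * ?a * (real (n div g) + 1) \<le> 2 * ?b * (ln (real n) ^ 2 + 1)" using d by (intro mono[OF qp]) simp_all
  ultimately show "real (8 * n * k + 4 * ((q + 1) * 3 ^ k) * k + 8 * n * g + n * (q + 1)
      + 2 * ((q + 1) * 3 ^ k) * (n div g + 1)) \<le> size_bound (real n)"
    unfolding size_bound_def of_nat_add of_nat_mult of_nat_power of_nat_numeral of_nat_1 by linarith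
qed

section \<open>Small \<open>n\<close> and the error term\<close>

text \<open>Clauses are sets of literals over \<open>vars F\<close>. So crude a count suffices, as
  it only fixes the error term where \<open>n\<close> is not large.\<close>

lemma card_two_cnf_le:
  assumes "two_cnf F"
  shows "card F \<le> 2 ^ (2 * card (vars F))"
proof -
  let ?L = "Pos ` vars F \<union> Neg ` vars F"
  have fin: "finite (vars F)" using assms by (rule finite_vars)
  have "F \<subseteq> Pow ?L"
  proof (intro subsetI PowI)
    fix C l assume "C \<in> F" "l \<in> C"
    then have "var_of l \<in> vars F" by (auto simp: vars_def clause_vars_def)
    then show "l \<in> ?L" by (cases l) auto
  qed
  then have "card F \<le> card (Pow ?L)" using fin by (intro card_mono) auto
  also have "\<dots> = 2 ^ card ?L" using fin by (simp add: card_Pow)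
  also have "\<dots> \<le> 2 ^ (2 * card (vars F))"
    using card_Un_le[of "Pos ` vars F" "Neg ` vars F"] card_image_le[OF fin, of Pos] card_image_le[OF fin, of Neg]
    by (intro power_increasing) linarith+
  finally show ?thesis .
qed

text \<open>For \<open>n \<le> 1\<close> the default values of \<open>log\<close> and of division by
  zero make the claimed bound 0, so the formula has to be empty.\<close>

lemma two_cnf_empty_if_card_vars_le_1:
  assumes "two_cnf F" "card (vars F) \<le> 1"
  shows "F = {}"
proof (rule ccontr)
  assume "F \<noteq> {}"
  then obtain C where C: "C \<in> F" by blast
  obtain l m where lm: "C = {l, m}" "var_of l \<noteq> var_of m" using two_cnf_clauseE[OF assms(1) C] .
  have "{var_of l, var_of m} \<subseteq> vars F" using C unfolding lm(1) by (auto simp: vars_def clause_vars_def intro!: bexI[of _ "{l, m}"])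
  then have "card {var_of l, var_of m} \<le> card (vars F)" by (intro card_mono finite_vars assms(1))
  then show False using lm(2) assms(2) by simp
qed

theorem theorem20:
  "\<exists>\<epsilon> :: nat \<Rightarrow> real. \<epsilon> \<longlonglongrightarrow> 0 \<and>
     (\<forall>(n::nat) (\<phi> :: 'v::infinite formula).
        simple_two_cnf \<phi> \<and> card (vars \<phi>) = n \<longrightarrow>
        (\<exists>\<phi>'. two_cnf \<phi>' \<and> bva_step\<^sup>*\<^sup>* \<phi> \<phi>' \<and>
           real (card \<phi>') \<le> (log 2 3 / 4 + \<epsilon> n) * ((real n)\<^sup>2 / log 2 (real n))))"
proof -
  define large where "large n \<longleftrightarrow> strip_width (real n) > 2 \<and> ln (real n) > 1" for n :: nat
  \<comment> \<open>Read off from the available bounds, both measured in units of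
    \<open>n^2 / log 2 n\<close>: for large \<open>n\<close> the excess over
    \<open>log 2 3 / 4\<close>, otherwise the trivial bound for the unchanged formula. The second
    case does not affect the limit, as it eventually ceases to occur.\<close>
  define \<epsilon> where "\<epsilon> n = (if large n then size_bound (real n) / 4 * (log 2 (real n) / (real n)\<^sup>2) - log 2 3 / 4
      else 2 ^ (2 * n) * (log 2 (real n) / (real n)\<^sup>2))" for n :: nat
  have "(\<lambda>n. size_bound (real n) / 4 * (log 2 (real n) / (real n)\<^sup>2) - log 2 3 / 4) \<longlonglongrightarrow> log 2 3 / 4 - log 2 3 / 4"
    by (intro tendsto_diff size_bound_tendsto tendsto_const)
  moreover have "\<forall>\<^sub>F n in sequentially. size_bound (real n) / 4 * (log 2 (real n) / (real n)\<^sup>2) - log 2 3 / 4 = \<epsilon> n"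
    using strip_width_eventually by eventually_elim (simp add: \<epsilon>_def large_def)
  ultimately have "\<epsilon> \<longlonglongrightarrow> log 2 3 / 4 - log 2 3 / 4" by (rule Lim_transform_eventually)
  then have lim: "\<epsilon> \<longlonglongrightarrow> 0" by simp
  have "\<exists>\<phi>'. two_cnf \<phi>' \<and> bva_step\<^sup>*\<^sup>* \<phi> \<phi>' \<and>
           real (card \<phi>') \<le> (log 2 3 / 4 + \<epsilon> n) * ((real n)\<^sup>2 / log 2 (real n))"
    if simple: "simple_two_cnf \<phi>" and n: "card (vars \<phi>) = n" for n and \<phi> :: "'v formula"
  proof -
    have two: "two_cnf \<phi>" using simple by (simp add: simple_two_cnf_def)
    have cancel: "log 2 (real n) / (real n)\<^sup>2 * ((real n)\<^sup>2 / log 2 (real n)) = 1"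
      and pos: "(real n)\<^sup>2 / log 2 (real n) > 0" if "n \<ge> 2"
    proof -
      have "log 2 (real n) > 0" "(real n)\<^sup>2 > 0" using that by simp_all
      moreover have "l / s * (s / l) = 1 \<and> s / l > 0" if "l > 0" "s > 0" for l s :: real using that by simp
      ultimately show "log 2 (real n) / (real n)\<^sup>2 * ((real n)\<^sup>2 / log 2 (real n)) = 1" "(real n)\<^sup>2 / log 2 (real n) > 0"
        by blast+
    qed
    consider "n \<le> 1" "\<not> large n" | "n \<ge> 2" "\<not> large n" | "large n" by linarith
    then show ?thesis
    proof cases
      case 1
      then have "\<phi> = {}" using two_cnf_empty_if_card_vars_le_1[OF two] n by simp
      moreover have "n = 0 \<or> n = 1" using 1(1) by auto
      ultimately show ?thesis using two by (intro exI[of _ \<phi>]) auto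
    next
      case 2
      have "real (card \<phi>) \<le> 2 ^ (2 * n)"
        using card_two_cnf_le[OF two] unfolding n by (metis of_nat_le_iff of_nat_numeral of_nat_power)
      also have "\<dots> = \<epsilon> n * ((real n)\<^sup>2 / log 2 (real n))"
        using cancel[OF 2(1)] 2(2) by (simp only: \<epsilon>_def if_False mult.assoc)
      also have "\<dots> \<le> (log 2 3 / 4 + \<epsilon> n) * ((real n)\<^sup>2 / log 2 (real n))"
        using pos[OF 2(1)] by (intro mult_right_mono) auto
      finally show ?thesis using two by (intro exI[of _ \<phi>]) simp
    next
      case 3
      then have large: "strip_width (real n) > 2" "ln (real n) > 1" by (simp_all add: large_def)
      have n2: "n \<ge> 2"
      proof (rule ccontr)
        assume "\<not> n \<ge> 2"
        then have "n = 0 \<or> n = 1" by auto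
        then show False using large(2) by auto
      qed
      let ?k = "nat \<lfloor>strip_width (real n)\<rfloor>" and ?g = "nat \<lceil>real n / ln (real n) ^ 2\<rceil>"
      let ?B = "8 * n * ?k + 4 * ((n div ?k + 1) * 3 ^ ?k) * ?k + 8 * n * ?g + n * (n div ?k + 1)
        + 2 * ((n div ?k + 1) * 3 ^ ?k) * (n div ?g + 1)"
      obtain F' where F': "two_cnf F'" "bva_step\<^sup>*\<^sup>* \<phi> F'" "4 * card F' \<le> ?B"
        using simple_two_cnf_compress[OF simple n compressed_size_le_size_bound(1,2)[OF large]] by (elim exE conjE)
      have "real (4 * card F') \<le> size_bound (real n)"
        using of_nat_mono[OF F'(3)] compressed_size_le_size_bound(3)[OF large] by (rule order_trans)
      then have "real (card F') \<le> size_bound (real n) / 4" by simp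
      also have "\<dots> = size_bound (real n) / 4 * (log 2 (real n) / (real n)\<^sup>2) * ((real n)\<^sup>2 / log 2 (real n))"
        using cancel[OF n2] by (simp only: mult.assoc)
      also have "size_bound (real n) / 4 * (log 2 (real n) / (real n)\<^sup>2) = log 2 3 / 4 + \<epsilon> n"
        using 3 by (simp add: \<epsilon>_def)
      finally show ?thesis using F'(1,2) by (intro exI[of _ F'] conjI)
    qed
  qed
  then show ?thesis using lim by blast
qed

end
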